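(* Let $(X,d)$ be a finite metric space and let $P^*$ be its conservative complete linkage partition. For every $r\ge0$ and every block $C\in P^*(r)$, $\mathrm{diam}(C)\le r$.
   Context: For disjoint nonempty subsets $A,B\subseteq X$ let $\ell(A,B)=\max_{x\in A,y\in B}d(x,y)$ (complete linkage). For a partition $Q$ of $X$ and $r\ge0$, the linkage graph $\Gamma_r(Q)$ has vertex set $Q$, with an edge between distinct blocks $B,B'\in Q$ if and only if $\ell(B,B')\le r$. Let $0<r_1<\dots<r_m$ be the distinct positive values of $d$, and $r_0=0$. The conservative complete linkage partition $P^*$ assigns to each $r\in[0,\infty)$ a partition $P^*(r)$ of $X$, defined inductively: $P^*(r)=\{\{x\}:x\in X\}$ for $r<r_1$. At each $r_i$, let $Q=P^*(r_{i-1})$; for each connected component $\mathcal{C}$ of $\Gamma_{r_i}(Q)$, if $\mathcal{C}$ is a clique in $\Gamma_{r_i}(Q)$ replace the blocks of $\mathcal{C}$ by the single block $\bigcup_{B\in\mathcal{C}}B$, and otherwise leave the blocks of $\mathcal{C}$ unchanged; the resulting partition is $P^*(r_i)$. Finally $P^*(r)=P^*(r_i)$ for $r\in[r_i,r_{i+1})$ (and for all $r\ge r_m$ when $i=m$). *)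

theory Defs
  imports "HOL-Analysis.Analysis" "HOL-Library.Ramsey"
begin

definition linkage :: "('a \<Rightarrow> 'a \<Rightarrow> real) \<Rightarrow> 'a set \<Rightarrow> 'a set \<Rightarrow> real" where
  "linkage d A B = Max {d x y | x y. x \<in> A \<and> y \<in> B}"

(* The linkage graph on the vertex set Q is given by its edge set: each edge is the
   two-element set of its end points, as in HOL-Library.Ramsey. *)
definition linkage_edges ::
    "('a \<Rightarrow> 'a \<Rightarrow> real) \<Rightarrow> real \<Rightarrow> 'a set set \<Rightarrow> 'a set set set" where
  "linkage_edges d r Q =
     {{B, B'} | B B'. B \<in> Q \<and> B' \<in> Q \<and> B \<noteq> B' \<and> linkage d B B' \<le> r}"

definition components :: "'v set \<Rightarrow> 'v set set \<Rightarrow> 'v set set" where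
  "components V E = V // {(u, v). u \<in> V \<and> v \<in> V \<and> (u, v) \<in> {(x, y). {x, y} \<in> E}\<^sup>*}"

definition merge_cliques ::
    "('a \<Rightarrow> 'a \<Rightarrow> real) \<Rightarrow> real \<Rightarrow> 'a set set \<Rightarrow> 'a set set" where
  "merge_cliques d r Q =
     (let E = linkage_edges d r Q
      in \<Union>\<C> \<in> components Q E. if clique \<C> E then {\<Union>\<C>} else \<C>)"

definition pos_values :: "'a set \<Rightarrow> ('a \<Rightarrow> 'a \<Rightarrow> real) \<Rightarrow> real set" where
  "pos_values X d = {d x y | x y. x \<in> X \<and> y \<in> X \<and> d x y > 0}"

(* The number r_i, for i at most m = card (pos_values X d). *)
definition scale :: "'a set \<Rightarrow> ('a \<Rightarrow> 'a \<Rightarrow> real) \<Rightarrow> nat \<Rightarrow> real" where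
  "scale X d i = (0 # sorted_list_of_set (pos_values X d)) ! i"

(* The partition at scale r_i, again for i at most m. *)
primrec ccl_step :: "'a set \<Rightarrow> ('a \<Rightarrow> 'a \<Rightarrow> real) \<Rightarrow> nat \<Rightarrow> 'a set set" where
  "ccl_step X d 0 = {{x} | x. x \<in> X}"
| "ccl_step X d (Suc i) = merge_cliques d (scale X d (Suc i)) (ccl_step X d i)"

(* The conservative complete linkage partition; meaningful only for r \<ge> 0. *)
definition ccl_partition :: "'a set \<Rightarrow> ('a \<Rightarrow> 'a \<Rightarrow> real) \<Rightarrow> real \<Rightarrow> 'a set set" where
  "ccl_partition X d r =
     ccl_step X d (Max {i. i \<le> card (pos_values X d) \<and> scale X d i \<le> r})"

(* The library's diameter, for a distance that is an explicit argument
   instead of the type class operation. *)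
definition diam :: "('a \<Rightarrow> 'a \<Rightarrow> real) \<Rightarrow> 'a set \<Rightarrow> real" where
  "diam d C = (if C = {} then 0 else SUP (x, y) \<in> C \<times> C. d x y)"

end

theory Submission
  imports Defs
begin

text \<open>Two points of a block produced by merging a clique lie either in the same old block or in two
  adjacent old blocks; in the latter case the linkage of these blocks is at most the current
  scale. Hence the bound \<open>d x y \<le> r\<^sub>i\<close> within blocks is an invariant of the construction, as the
  scales increase.\<close>

lemma le_linkage:
  assumes "finite A" "finite B" "x \<in> A" "y \<in> B"
  shows "d x y \<le> linkage d A B"
proof -
  have "{d x y | x y. x \<in> A \<and> y \<in> B} = (\<lambda>(x, y). d x y) ` (A \<times> B)"
    by auto
  with assms have "finite {d x y | x y. x \<in> A \<and> y \<in> B}"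
    by simp
  with assms show ?thesis
    unfolding linkage_def by (auto intro!: Max_ge)
qed

text \<open>An edge is an unordered pair, so membership bounds \<open>linkage\<close> in only one of
  the two orders of its end points. Symmetry of \<open>d\<close> makes either order
  sufficient.\<close>

lemma linkage_edges_le:
  assumes "{A, B} \<in> linkage_edges d r Q" "finite A" "finite B" "x \<in> A" "y \<in> B"
    and sym: "\<And>x y. d x y = d y x"
  shows "d x y \<le> r"
proof -
  have "linkage d A B \<le> r \<or> linkage d B A \<le> r"
    using assms(1) by (auto simp: linkage_edges_def doubleton_eq_iff)
  then show ?thesis
    using le_linkage[of A B x y d] le_linkage[of B A y x d] assms(2-5) sym[of x y] by auto
qed

lemma components_subset: "\<C> \<in> components V E \<Longrightarrow> \<C> \<subseteq> V"
  by (auto simp: components_def quotient_def)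

lemma merge_cliques_cases:
  assumes "C \<in> merge_cliques d r Q"
  obtains "C \<in> Q"
    | \<C> where "\<C> \<subseteq> Q" "clique \<C> (linkage_edges d r Q)" "C = \<Union>\<C>"
proof -
  from assms obtain \<C> where \<C>: "\<C> \<in> components Q (linkage_edges d r Q)"
    and C: "C \<in> (if clique \<C> (linkage_edges d r Q) then {\<Union>\<C>} else \<C>)"
    by (auto simp: merge_cliques_def Let_def)
  from \<C> have "\<C> \<subseteq> Q"
    by (rule components_subset)
  with C that show thesis
    by (cases "clique \<C> (linkage_edges d r Q)") auto
qed

text \<open>This is the induction step. The inclusion in \<open>X\<close> is carried along because
  it makes the blocks finite, so that the \<open>Max\<close> in \<open>linkage\<close> really bounds
  all distances between two blocks.\<close>

lemma merge_cliques_bounded: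
  assumes sym: "\<And>x y. d x y = d y x"
    and "finite X"
    and Q: "\<And>B. B \<in> Q \<Longrightarrow> B \<subseteq> X \<and> (\<forall>x\<in>B. \<forall>y\<in>B. d x y \<le> s)"
    and "s \<le> r"
    and "C \<in> merge_cliques d r Q"
  shows "C \<subseteq> X \<and> (\<forall>x\<in>C. \<forall>y\<in>C. d x y \<le> r)"
  using assms(5)
proof (cases rule: merge_cliques_cases)
  case 1
  then show ?thesis
    using Q \<open>s \<le> r\<close> by force
next
  case (2 \<C>)
  have "d x y \<le> r" if "x \<in> A" "y \<in> B" "A \<in> \<C>" "B \<in> \<C>" for x y A B
  proof (cases "A = B")
    case True
    then show ?thesis
      using that 2(1) Q \<open>s \<le> r\<close> by force
  next
    case False
    then have "{A, B} \<in> linkage_edges d r Q"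
      using that 2(2) by (auto simp: clique_def)
    moreover have "finite A" "finite B"
      using that 2(1) Q \<open>finite X\<close> by (meson finite_subset subsetD)+
    ultimately show ?thesis
      using that(1,2) sym by (rule linkage_edges_le)
  qed
  then show ?thesis
    using 2 Q by blast
qed

lemma finite_pos_values: "finite X \<Longrightarrow> finite (pos_values X d)"
  by (rule finite_subset[of _ "(\<lambda>(x, y). d x y) ` (X \<times> X)"]) (auto simp: pos_values_def)

lemma scale_mono:
  assumes "finite X" "i \<le> j" "j \<le> card (pos_values X d)"
  shows "scale X d i \<le> scale X d j"
proof -
  \<comment> \<open>The leading 0 respects the order because every member of
    \<open>pos_values X d\<close> is positive.\<close>
  have "sorted (0 # sorted_list_of_set (pos_values X d))"
    using finite_pos_values[OF assms(1)] by (auto simp: pos_values_def)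
  then show ?thesis
    using assms unfolding scale_def by (intro sorted_nth_mono) auto
qed

text \<open>The bound on \<open>i\<close> keeps the index inside the list of scales, where
  \<open>scale\<close> is monotone.\<close>

lemma ccl_step_bounded:
  assumes "Metric_space X d" "finite X" "i \<le> card (pos_values X d)" "C \<in> ccl_step X d i"
  shows "C \<subseteq> X \<and> (\<forall>x\<in>C. \<forall>y\<in>C. d x y \<le> scale X d i)"
  using assms(3,4)
proof (induction i arbitrary: C)
  case 0
  have "d x x = 0" if "x \<in> X" for x
    using Metric_space.zero[OF assms(1) that that] by simp
  with 0 show ?case
    by (auto simp: scale_def)
next
  case (Suc i)
  show ?case
  proof (rule merge_cliques_bounded)
    show "d x y = d y x" for x y
      using assms(1) by (rule Metric_space.commute)
    show "scale X d i \<le> scale X d (Suc i)"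
      using assms(2) Suc.prems by (intro scale_mono) auto
  qed (use assms Suc in auto)
qed

theorem proposition5p8:
  fixes X :: "'a set" and d :: "'a \<Rightarrow> 'a \<Rightarrow> real" and r :: real and C :: "'a set"
  assumes "Metric_space X d"
    and "finite X"
    and "r \<ge> 0"
    and "C \<in> ccl_partition X d r"
  shows "diam d C \<le> r"
proof -
  define I where "I = {i. i \<le> card (pos_values X d) \<and> scale X d i \<le> r}"
  \<comment> \<open>Index 0 qualifies because its scale is 0 and \<open>r\<close> is nonnegative;
    hence the maximum is attained in \<open>I\<close>.\<close>
  have "finite I" "0 \<in> I"
    using \<open>r \<ge> 0\<close> by (auto simp: I_def scale_def)
  then have "Max I \<in> I"
    using Max_in by blast
  then have le: "Max I \<le> card (pos_values X d)" "scale X d (Max I) \<le> r"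
    by (auto simp: I_def)
  have "C \<in> ccl_step X d (Max I)"
    using assms(4) by (simp add: ccl_partition_def I_def)
  then have "\<forall>x\<in>C. \<forall>y\<in>C. d x y \<le> r"
    using ccl_step_bounded[OF assms(1,2) le(1)] le(2) by force
  \<comment> \<open>For empty \<open>C\<close> the diameter is 0 by convention, and
    \<open>r \<ge> 0\<close> applies; otherwise the supremum runs over a nonempty set and is at most
    any pointwise bound.\<close>
  then show ?thesis
    using \<open>r \<ge> 0\<close> by (auto simp: diam_def intro!: cSUP_least)
qed

end
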